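(* Let $B\in\mathrm{M}_3(\mathbb{R})$ be a cluster-cyclic skew-symmetrizable matrix with skew-symmetrizer $D$, and let $\mathbf w=[k_1,\dots,k_r]\in\mathcal T$ with $r\ge1$. Then $(C^{\mathbf w})^{\top}\tilde A_{k_1}C^{\mathbf w}=\tilde A^{\mathbf w}$.
   Context: A matrix $B=(b_{ij})\in\mathrm{M}_3(\mathbb{R})$ is skew-symmetrizable with skew-symmetrizer $D=\mathrm{diag}(d_1,d_2,d_3)$ ($d_i>0$) if $DB$ is skew-symmetric. Notation: $[a]_+=\max(a,0)$, entrywise on matrices; $J_k$ is diagonal with $k$th entry $-1$, others $1$; $A^{\bullet k}$ (resp. $A^{k\bullet}$) keeps only the $k$th column (resp. row) of $A$. Mutation: $\mu_k(B)=(J_k+[-B]_+^{\bullet k})B(J_k+[B]_+^{k\bullet})$. $\mathcal T$ is the set of reduced sequences $\mathbf w=[k_1,\dots,k_r]$ ($k_i\in\{1,2,3\}$, $k_i\ne k_{i+1}$), including $\emptyset$; $\mathbf w[k]$ appends $k$ if $\mathbf w=\emptyset$ or $k\ne k_r$ and deletes the last entry if $k=k_r$. $B^{\mathbf w}=\mu_{k_r}\cdots\mu_{k_1}(B)=(b^{\mathbf w}_{ij})$. $C^\emptyset=I$, $C^{\mathbf w[k]}=C^{\mathbf w}J_k+C^{\mathbf w}[B^{\mathbf w}]_+^{k\bullet}+[-C^{\mathbf w}]_+^{\bullet k}B^{\mathbf w}$, columns $\mathbf c_i^{\mathbf w}$. $B$ is cyclic if $\mathrm{sign}(B)=\pm\begin{pmatrix}0&-1&1\\1&0&-1\\-1&1&0\end{pmatrix}$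 entrywise; cluster-cyclic if all $B^{\mathbf w}$ are cyclic. For cluster-cyclic $B$ every $\mathbf c_i^{\mathbf w}$ is nonzero and componentwise $\ge0$ or $\le0$, with tropical sign $\varepsilon_i^{\mathbf w}\in\{\pm1\}$ such that $\varepsilon_i^{\mathbf w}\mathbf c_i^{\mathbf w}\ge\mathbf 0$. For $q\in\{1,2,3\}$, $A_q=(a_{ij})$ is the $3\times3$ matrix with $a_{ii}=2$ and $a_{ij}=\epsilon^q_{ij}|b_{ij}|$ for $i\ne j$, where $\epsilon^q_{ij}=1$ if $q\notin\{i,j\}$ and $\epsilon^q_{ij}=-1$ if $q\in\{i,j\}$; $\tilde A_q=DA_q$. For $|\mathbf w|\ge1$ let $\mathcal P^{\mathbf w}=\{(i,j)\mid\varepsilon_i^{\mathbf w}b_{ij}^{\mathbf w}>0$ or $\varepsilon_j^{\mathbf w}b_{ji}^{\mathbf w}>0\}$, and let $A^{\mathbf w}=(a^{\mathbf w}_{ij})$ with $a^{\mathbf w}_{ii}=2$, $a^{\mathbf w}_{ij}=-|b^{\mathbf w}_{ij}|$ if $i\ne j$ and $(i,j)\in\mathcal P^{\mathbf w}$, and $a^{\mathbf w}_{ij}=|b^{\mathbf w}_{ij}|$ if $i\ne j$ and $(i,j)\notin\mathcal P^{\mathbf w}$; $\tilde A^{\mathbf w}=DA^{\mathbf w}$. *)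

theory Defs
  imports "HOL-Analysis.Analysis"
begin

text \<open>Matrices are of type \<^typ>\<open>real^3^3\<close>, whose index type has exactly the three elements 1, 2, 3
  (in this type \<open>3 = 0\<close>).\<close>

definition diag_mat :: "real^3 \<Rightarrow> real^3^3" where
  "diag_mat d = (\<chi> i j. if i = j then d $ i else 0)"

definition skew_symmetrizer :: "real^3^3 \<Rightarrow> real^3^3 \<Rightarrow> bool" where
  "skew_symmetrizer D B \<longleftrightarrow>
     (\<exists>d. (\<forall>i. d $ i > 0) \<and> D = diag_mat d) \<and> transpose (D ** B) = - (D ** B)"

definition pos_mat :: "real^3^3 \<Rightarrow> real^3^3" where
  "pos_mat A = (\<chi> i j. max (A $ i $ j) 0)"

definition J_mat :: "3 \<Rightarrow> real^3^3" where
  "J_mat k = diag_mat (\<chi> i. if i = k then -1 else 1)"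

definition col_part :: "3 \<Rightarrow> real^3^3 \<Rightarrow> real^3^3" where
  "col_part k A = (\<chi> i j. if j = k then A $ i $ j else 0)"

definition row_part :: "3 \<Rightarrow> real^3^3 \<Rightarrow> real^3^3" where
  "row_part k A = (\<chi> i j. if i = k then A $ i $ j else 0)"

definition mutation :: "3 \<Rightarrow> real^3^3 \<Rightarrow> real^3^3" where
  "mutation k B =
     (J_mat k + col_part k (pos_mat (- B))) ** B ** (J_mat k + row_part k (pos_mat B))"

definition C_step :: "3 \<Rightarrow> real^3^3 \<Rightarrow> real^3^3 \<Rightarrow> real^3^3" where
  "C_step k B C = C ** J_mat k + C ** row_part k (pos_mat B) + col_part k (pos_mat (- C)) ** B"

text \<open>Words \<open>[k\<^sub>1, \<dots>, k\<^sub>r]\<close> are lists whose head \<open>k\<^sub>1\<close> is applied first; the reduced ones are those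
  satisfying \<^const>\<open>distinct_adj\<close>. \<open>B_word\<close> and \<open>C_word\<close> are defined for all lists; the lemmas
  below are their defining recursions.\<close>

definition B_word :: "real^3^3 \<Rightarrow> 3 list \<Rightarrow> real^3^3" where
  "B_word B w = foldl (\<lambda>B' k. mutation k B') B w"

definition BC_word :: "real^3^3 \<Rightarrow> 3 list \<Rightarrow> (real^3^3) \<times> (real^3^3)" where
  "BC_word B w = foldl (\<lambda>(B', C') k. (mutation k B', C_step k B' C')) (B, mat 1) w"

definition C_word :: "real^3^3 \<Rightarrow> 3 list \<Rightarrow> real^3^3" where
  "C_word B w = snd (BC_word B w)"

lemma fst_BC_word: "fst (BC_word B w) = B_word B w"
  by (induction w rule: rev_induct) (auto simp: BC_word_def B_word_def split: prod.splits)

lemma B_word_Nil: "B_word B [] = B"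
  and B_word_snoc: "B_word B (w @ [k]) = mutation k (B_word B w)"
  by (simp_all add: B_word_def)

lemma C_word_Nil: "C_word B [] = mat 1"
  by (simp add: C_word_def BC_word_def)

lemma C_word_snoc: "C_word B (w @ [k]) = C_step k (B_word B w) (C_word B w)"
  unfolding fst_BC_word[symmetric] by (simp add: C_word_def BC_word_def split_beta)

definition cyclic_mat :: "real^3^3 \<Rightarrow> bool" where
  "cyclic_mat B \<longleftrightarrow>
     (let S = vector [vector [0, -1, 1], vector [1, 0, -1], vector [-1, 1, 0]];
          sgnB = (\<chi> i j. sgn (B $ i $ j))
      in sgnB = S \<or> sgnB = - S)"

definition cluster_cyclic :: "real^3^3 \<Rightarrow> bool" where
  "cluster_cyclic B \<longleftrightarrow> (\<forall>w. distinct_adj w \<longrightarrow> cyclic_mat (B_word B w))"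

text \<open>The order on \<^typ>\<open>real^3\<close> is the componentwise one. The sign is uniquely determined exactly
  when the c-vector is nonzero and sign-coherent; this is a theorem for cluster-cyclic matrices,
  not an assumption built into the definition.\<close>

definition tropical_sign :: "real^3^3 \<Rightarrow> 3 list \<Rightarrow> 3 \<Rightarrow> real" where
  "tropical_sign B w i = (THE e. e \<in> {1, -1} \<and> 0 \<le> e *\<^sub>R column i (C_word B w))"

definition A_init :: "real^3^3 \<Rightarrow> 3 \<Rightarrow> real^3^3" where
  "A_init B q = (\<chi> i j. if i = j then 2
                        else (if q \<in> {i, j} then -1 else 1) * \<bar>B $ i $ j\<bar>)"

definition P_word :: "real^3^3 \<Rightarrow> 3 list \<Rightarrow> (3 \<times> 3) set" where
  "P_word B w = {(i, j). tropical_sign B w i * B_word B w $ i $ j > 0 \<or>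
                         tropical_sign B w j * B_word B w $ j $ i > 0}"

definition A_word :: "real^3^3 \<Rightarrow> 3 list \<Rightarrow> real^3^3" where
  "A_word B w = (\<chi> i j. if i = j then 2
                        else if (i, j) \<in> P_word B w then - \<bar>B_word B w $ i $ j\<bar>
                        else \<bar>B_word B w $ i $ j\<bar>)"

end

theory Submission
  imports Defs
begin

text \<open>The columns of \<open>C\<^sup>w\<close> have Gram matrix \<open>D A\<^sup>w\<close> for the form \<open>D A\<^sub>q\<close>: a mutation at \<open>k\<close> negates
  \<open>c\<^sub>k\<close> and reflects exactly one other c-vector in \<open>c\<^sub>k\<close>, once sign-coherence is known. The only
  delicate case for sign-coherence is the one where \<open>c\<^sub>j\<close> and \<open>c\<^sub>k\<close> have opposite signs and \<open>c\<^sub>j\<close>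
  absorbs a multiple of \<open>c\<^sub>k\<close>. Then \<open>j\<close> was mutated last and \<open>c\<^sub>k\<close> absorbed \<open>c\<^sub>j\<close>, so that
  \<open>\<bar>c\<^sub>j\<bar> / sqrt (d j) \<le> \<bar>c\<^sub>k\<bar> / sqrt (d k)\<close> componentwise; since cluster-cyclicity forces
  \<open>\<bar>b\<^sub>k\<^sub>j b\<^sub>j\<^sub>k\<bar> \<ge> 4\<close>, the absorbed multiple dominates and the inequality is reproduced.\<close>

section \<open>The three-element index type, cyclic sign patterns and a linear recurrence\<close>

lemma sum_UNIV_three:
  fixes f :: "3 \<Rightarrow> 'b::comm_monoid_add"
  assumes "distinct [k, j, l]"
  shows "sum f UNIV = f k + f j + f l"
proof -
  have "(UNIV :: 3 set) = {k, j, l}"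
    using assms exhaust_3[of k] exhaust_3[of j] exhaust_3[of l] by (auto simp: UNIV_3)
  then have "sum f UNIV = sum f {k, j, l}" by (rule arg_cong)
  also have "\<dots> = f k + f j + f l" using assms by (simp add: add.assoc)
  finally show ?thesis .
qed

lemma three_cases:
  fixes i k j l :: 3
  assumes "distinct [k, j, l]"
  shows "i = k \<or> i = j \<or> i = l"
  using assms exhaust_3[of k] exhaust_3[of j] exhaust_3[of l] exhaust_3[of i] by auto

lemma ex_distinct_three:
  fixes k :: 3
  obtains j l where "distinct [k, j, l]"
  using exhaust_3[of k] that[of 2 3] that[of 1 3] that[of 1 2] by auto

lemma cyclic_mat_orientation:
  assumes "cyclic_mat M" "distinct [k, j, l]"
  obtains s :: real where "s \<in> {1, -1}" "s * M $ k $ j > 0" "s * M $ j $ l > 0" "s * M $ l $ k > 0"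
proof -
  let ?Q = "\<lambda>s::real. s * M $ k $ j > 0 \<and> s * M $ j $ l > 0 \<and> s * M $ l $ k > 0"
  have "?Q 1 \<or> ?Q (-1)"
    using assms exhaust_3[of k] exhaust_3[of j] exhaust_3[of l]
    by (auto simp: cyclic_mat_def Let_def vec_eq_iff forall_3 sgn_1_pos sgn_1_neg)
  then show thesis using that by blast
qed

text \<open>On a column of constant sign \<open>s\<close> the two positive-part terms of
  \<open>C_step\<close> merge into one, because \<open>max x 0 - x = max (- x) 0\<close>.\<close>

lemma C_step_entry:
  assumes "M $ k $ k = 0" "s \<in> {1, -1}" "\<And>i. s * C $ i $ k \<ge> 0"
  shows "C_step k M C $ i $ j = (if j = k then - C $ i $ k
           else C $ i $ j + max (s * M $ k $ j) 0 * C $ i $ k)"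
proof -
  obtain a b where abk: "distinct [k, a, b]" using ex_distinct_three by blast
  show ?thesis
    using assms(1,2) assms(3)[of i] abk three_cases[OF abk, of j]
    by (auto simp: C_step_def J_mat_def diag_mat_def row_part_def col_part_def pos_mat_def
        matrix_matrix_mult_def sum_UNIV_three[OF abk] max_def algebra_simps)
qed

text \<open>If \<open>p < 2\<close>, the increments strictly decrease. A negative increment would
  drive \<open>t\<close> below zero, so \<open>t\<close> stays at or above \<open>t 0 > 0\<close>;
  but then the increments lose at least \<open>(2 - p) * t 0\<close> each time and become
  negative.\<close>

lemma recurrence_positive_imp_ge_2:
  fixes t :: "nat \<Rightarrow> real"
  assumes pos: "\<And>n. t n > 0" and rec: "\<And>n. t (Suc (Suc n)) = p * t (Suc n) - t n"
  shows "p \<ge> 2"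
proof (rule ccontr)
  assume "\<not> p \<ge> 2"
  then have p: "2 - p > 0" by simp
  define \<delta> where "\<delta> n = t (Suc n) - t n" for n
  have \<delta>_Suc: "\<delta> (Suc n) = \<delta> n - (2 - p) * t (Suc n)" for n
    by (simp add: \<delta>_def rec algebra_simps)
  have unbounded: False if c: "c > 0" and dec: "\<And>n. f (Suc n) \<le> f n - c" and nn: "\<And>n. f n \<ge> 0"
    for f :: "nat \<Rightarrow> real" and c
  proof -
    have lin: "f n \<le> f 0 - n * c" for n
    proof (induction n)
      case (Suc n)
      then show ?case using dec[of n] by (simp add: algebra_simps)
    qed simp
    obtain n :: nat where "n * c > f 0" using reals_Archimedean3[OF c] by blast
    then show False using lin[of n] nn[of n] by linarith
  qed
  have \<delta>_nonneg: "\<delta> n \<ge> 0" for n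
  proof (rule ccontr)
    assume neg: "\<not> \<delta> n \<ge> 0"
    have le: "\<delta> (m + n) \<le> \<delta> n" for m
    proof (induction m)
      case (Suc m)
      then show ?case using \<delta>_Suc[of "m + n"] mult_pos_pos[OF p pos[of "Suc (m + n)"]] by simp
    qed simp
    show False
    proof (rule unbounded[of "- \<delta> n" "\<lambda>m. t (m + n)"])
      show "t (Suc m + n) \<le> t (m + n) - - \<delta> n" for m
        using le[of m] by (simp add: \<delta>_def)
    qed (use neg pos in \<open>auto intro: less_imp_le\<close>)
  qed
  have t_ge: "t n \<ge> t 0" for n
  proof (induction n)
    case (Suc n)
    then show ?case using \<delta>_nonneg[of n] by (simp add: \<delta>_def)
  qed simp
  show False
  proof (rule unbounded[of "(2 - p) * t 0" \<delta>])
    show "\<delta> (Suc n) \<le> \<delta> n - (2 - p) * t 0" for n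
      using \<delta>_Suc[of n] mult_left_mono[OF t_ge[of "Suc n"], of "2 - p"] p by simp
  qed (use p pos \<delta>_nonneg in auto)
qed

section \<open>Orientation of exchange matrices under mutation, for a fixed skew-symmetrizer\<close>

locale exchange =
  fixes B :: "real^3^3" and d :: "3 \<Rightarrow> real"
  assumes d_pos: "d i > 0"
    and skew_B: "d i * B $ i $ j = - d j * B $ j $ i"
    and cc: "cluster_cyclic B"
begin

definition skew :: "real^3^3 \<Rightarrow> bool" where
  "skew M \<longleftrightarrow> (\<forall>i j. d i * M $ i $ j = - d j * M $ j $ i)"

lemma skewD: "skew M \<Longrightarrow> d i * M $ i $ j = - d j * M $ j $ i"
  unfolding skew_def by blast

lemma skew_diag: "skew M \<Longrightarrow> M $ i $ i = 0"
  using skewD[of M i i] d_pos[of i] by simp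

lemma skew_mult_pos_iff:
  assumes "skew M"
  shows "s * M $ i $ j > 0 \<longleftrightarrow> s * M $ j $ i < 0"
proof -
  have "d i * (s * M $ i $ j) = - d j * (s * M $ j $ i)"
    using skewD[OF assms, of i j] by (simp add: algebra_simps)
  then have "d i * (s * M $ i $ j) > 0 \<longleftrightarrow> d j * (s * M $ j $ i) < 0" by simp
  then show ?thesis
    using d_pos[of i] d_pos[of j] by (simp only: zero_less_mult_iff mult_less_0_iff) auto
qed

text \<open>When \<open>s\<close> is the sign of the c-vector of \<open>k\<close>, the orientation
  singles out \<open>j\<close> as the index whose c-vector absorbs a multiple of it; that of
  \<open>l\<close> stays unchanged.\<close>

definition oriented :: "real \<Rightarrow> 3 \<Rightarrow> 3 \<Rightarrow> 3 \<Rightarrow> real^3^3 \<Rightarrow> bool" where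
  "oriented s k j l M \<longleftrightarrow> s \<in> {1, -1} \<and> distinct [k, j, l] \<and> skew M \<and>
     s * M $ k $ j > 0 \<and> s * M $ j $ l > 0 \<and> s * M $ l $ k > 0"

lemma orientedD:
  assumes "oriented s k j l M"
  shows "s \<in> {1, -1}" "distinct [k, j, l]" "skew M"
    "s * M $ k $ j > 0" "s * M $ j $ l > 0" "s * M $ l $ k > 0"
    "s * M $ j $ k < 0" "s * M $ l $ j < 0" "s * M $ k $ l < 0"
  using assms skew_mult_pos_iff[of M] unfolding oriented_def by blast+

lemma mutation_oriented:
  assumes "oriented s k j l M"
  shows "mutation k M $ k $ k = 0"
    "mutation k M $ k $ j = - M $ k $ j" "mutation k M $ j $ k = - M $ j $ k"
    "mutation k M $ k $ l = - M $ k $ l" "mutation k M $ l $ k = - M $ l $ k"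
    "mutation k M $ j $ l = M $ j $ l - s * M $ j $ k * M $ k $ l"
    "mutation k M $ l $ j = M $ l $ j + s * M $ l $ k * M $ k $ j"
    "mutation k M $ j $ j = 0" "mutation k M $ l $ l = 0"
  using orientedD[OF assms] skew_diag[OF orientedD(3)[OF assms]]
  by (auto simp: mutation_def J_mat_def diag_mat_def row_part_def col_part_def pos_mat_def
      matrix_matrix_mult_def sum_UNIV_three[OF orientedD(2)[OF assms]] max_def algebra_simps)

lemma skew_mutation:
  assumes "oriented s k j l M"
  shows "skew (mutation k M)"
proof -
  note O = orientedD[OF assms] and mut = mutation_oriented[OF assms]
  note sk = skewD[OF O(3)]
  have "d j * (s * M $ j $ k * M $ k $ l) = s * (d j * M $ j $ k) * M $ k $ l"
    "d l * (s * M $ l $ k * M $ k $ j) = s * (d l * M $ l $ k) * M $ k $ j"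
    by simp_all
  then have "d j * mutation k M $ j $ l = - d l * mutation k M $ l $ j"
    unfolding mut using sk[of j l] sk[of j k] sk[of l k] by (simp add: algebra_simps)
  then have jl: "d j * mutation k M $ j $ l = - d l * mutation k M $ l $ j"
    "d l * mutation k M $ l $ j = - d j * mutation k M $ j $ l" by simp_all
  have "d i * mutation k M $ i $ i' = - d i' * mutation k M $ i' $ i" for i i'
    using three_cases[OF O(2), of i] three_cases[OF O(2), of i'] jl
      sk[of j k] sk[of l k] by (elim disjE) (simp_all add: mut del: mut(6,7))
  then show ?thesis unfolding skew_def by blast
qed

text \<open>The entry at \<open>j\<close>, \<open>k\<close> is merely negated, and its sign alone
  decides which of the two cyclic patterns the mutated matrix has.\<close>

lemma oriented_mutation:
  assumes "oriented s k j l M" "cyclic_mat (mutation k M)"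
  shows "oriented s j k l (mutation k M)"
proof -
  note O = orientedD[OF assms(1)]
  have di: "distinct [j, k, l]" using O(2) by auto
  obtain r where r: "r \<in> {1, -1}" "r * mutation k M $ j $ k > 0" "r * mutation k M $ k $ l > 0"
      "r * mutation k M $ l $ j > 0"
    using cyclic_mat_orientation[OF assms(2) di] by blast
  moreover have "s * mutation k M $ j $ k > 0"
    using O(7) by (simp add: mutation_oriented(3)[OF assms(1)])
  ultimately have "r = s" using O(1) by auto
  then show ?thesis unfolding oriented_def using r di skew_mutation[OF assms(1)] by blast
qed

lemma orientation_exists:
  assumes "skew M" "cyclic_mat M" "s \<in> {1, -1}"
  obtains j l where "oriented s k j l M"
proof -
  obtain j l where jl: "distinct [k, j, l]" using ex_distinct_three by blast
  then obtain r where r: "r \<in> {1, -1}" "r * M $ k $ j > 0" "r * M $ j $ l > 0" "r * M $ l $ k > 0"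
    using cyclic_mat_orientation[OF assms(2)] by blast
  \<comment> \<open>Exchanging \<open>j\<close> and \<open>l\<close> reverses the cycle, so either
    sign can be prescribed.\<close>
  consider "r = s" | "r = - s" using r(1) assms(3) by auto
  then show thesis
  proof cases
    case 1
    then show thesis using that[of j l] assms jl r by (auto simp: oriented_def)
  next
    case 2
    have "s * M $ k $ l > 0" "s * M $ l $ j > 0" "s * M $ j $ k > 0"
      using 2 r skew_mult_pos_iff[OF assms(1), of s] by simp_all
    then show thesis using that[of l j] assms jl by (auto simp: oriented_def)
  qed
qed

section \<open>Exchange matrices along a word and a lower bound for their entries\<close>

lemma cyclic_word: "distinct_adj w \<Longrightarrow> cyclic_mat (B_word B w)"
  using cc by (simp add: cluster_cyclic_def)

lemma skew_word: "distinct_adj w \<Longrightarrow> skew (B_word B w)"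
proof (induction w rule: rev_induct)
  case Nil
  then show ?case unfolding skew_def B_word_Nil using skew_B by blast
next
  case (snoc k w)
  then have w: "distinct_adj w" by (simp add: distinct_adj_append_iff)
  obtain j l where "oriented 1 k j l (B_word B w)"
    by (rule orientation_exists[OF snoc.IH[OF w] cyclic_word[OF w], where s = 1 and k = k]) auto
  then show ?case by (simp add: B_word_snoc skew_mutation)
qed

text \<open>Alternating mutations at \<open>k\<close> and \<open>j\<close> leave \<open>p = sqrt (d k / d j) * \<bar>b\<^sub>k\<^sub>j\<bar> = sqrt \<bar>b\<^sub>k\<^sub>j b\<^sub>j\<^sub>k\<bar>\<close>
  unchanged, while the symmetrized sizes of the two entries in the column of \<open>l\<close> form a positive
  sequence with \<open>t\<^sub>n\<^sub>+\<^sub>2 = p t\<^sub>n\<^sub>+\<^sub>1 - t\<^sub>n\<close>, which forces \<open>p \<ge> 2\<close>.\<close>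

lemma entry_ge_2:
  assumes "distinct_adj (w @ [k])" "oriented s k j l (B_word B w)"
  shows "sqrt (d k) * (s * B_word B w $ k $ j) \<ge> 2 * sqrt (d j)"
proof -
  have sd: "sqrt (d i) > 0" "sqrt (d i) * sqrt (d i) = d i" for i
    using d_pos[of i] by (simp_all add: less_imp_le)
  define p where "p = sqrt (d k) * (s * B_word B w $ k $ j) / sqrt (d j)"
  define st where "st M k j l x y \<longleftrightarrow> oriented s k j l M \<and>
      sqrt (d k) * (s * M $ k $ j) = p * sqrt (d j) \<and>
      x = sqrt (d j) * (s * M $ j $ l) \<and> y = - (sqrt (d k) * (s * M $ k $ l))"
    for M k j l x y
  define t where "t = rec_nat (sqrt (d j) * (s * B_word B w $ j $ l),
      - (sqrt (d k) * (s * B_word B w $ k $ l))) (\<lambda>_ (x, y). (y, p * y - x))"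
  have t_Suc: "t (Suc n) = (snd (t n), p * snd (t n) - fst (t n))" for n
    by (simp add: t_def split_beta)
  have step: "st (mutation k M) j k l y (p * y - x)"
    if "st M k j l x y" "cyclic_mat (mutation k M)" for M k j l x y
  proof -
    have o: "oriented s k j l M" and pM: "sqrt (d k) * (s * M $ k $ j) = p * sqrt (d j)"
      and x: "x = sqrt (d j) * (s * M $ j $ l)" and y: "y = - (sqrt (d k) * (s * M $ k $ l))"
      using that(1) by (auto simp: st_def)
    note mut = mutation_oriented[OF o]
    \<comment> \<open>By skew-symmetry the transposed entry carries the same \<open>p\<close>, so
      \<open>p\<close> survives the exchange of \<open>k\<close> and \<open>j\<close>.\<close>
    have "sqrt (d j) * (sqrt (d j) * (s * M $ j $ k)) = s * (d j * M $ j $ k)"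
      using sd(2)[of j] by (simp add: mult.assoc[symmetric])
    also have "\<dots> = - (sqrt (d k) * (sqrt (d k) * (s * M $ k $ j)))"
      using sd(2)[of k] skewD[OF orientedD(3)[OF o], of j k] by (simp add: mult.assoc[symmetric])
    also have "\<dots> = sqrt (d j) * (- p * sqrt (d k))"
      unfolding pM by simp
    finally have pM': "sqrt (d j) * (s * M $ j $ k) = - p * sqrt (d k)"
      using sd(1)[of j] mult_left_cancel[of "sqrt (d j)"] by (metis less_irrefl)
    have ss: "s * s = 1" using orientedD(1)[OF o] by auto
    have "sqrt (d j) * (s * (s * M $ j $ k * M $ k $ l)) = s * (sqrt (d j) * (s * M $ j $ k)) * M $ k $ l"
      by simp
    also have "\<dots> = p * y" unfolding pM' y by simp
    finally have "p * y - x = - (sqrt (d j) * (s * mutation k M $ j $ l))"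
      unfolding mut x by (simp add: right_diff_distrib)
    then show ?thesis
      unfolding st_def using oriented_mutation[OF o that(2)] pM' y by (simp add: mut)
  qed
  \<comment> \<open>The word grows and \<open>k\<close>, \<open>j\<close> swap at every step, hence
    the existentials; the word must stay reduced for cluster-cyclicity to apply.\<close>
  have inv: "\<exists>w k j l. distinct_adj (w @ [k]) \<and> st (B_word B w) k j l (fst (t n)) (snd (t n))" for n
  proof (induction n)
    case 0
    have "st (B_word B w) k j l (fst (t 0)) (snd (t 0))"
      using assms(2) sd(1)[of j] by (simp add: st_def t_def p_def)
    then show ?case using assms(1) by blast
  next
    case (Suc n)
    then obtain w k j l where w: "distinct_adj (w @ [k])"
      and s: "st (B_word B w) k j l (fst (t n)) (snd (t n))" by blast
    then have "st (B_word B (w @ [k])) j k l (fst (t (Suc n))) (snd (t (Suc n)))"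
      using step[OF s] cyclic_word[OF w] by (simp add: B_word_snoc t_Suc)
    moreover have "distinct_adj ((w @ [k]) @ [j])"
      using w s by (simp add: distinct_adj_append_iff st_def oriented_def)
    ultimately show ?case by blast
  qed
  have "p \<ge> 2"
  proof (rule recurrence_positive_imp_ge_2[of "\<lambda>n. fst (t n)"])
    fix n
    show "fst (t n) > 0"
      using inv[of n] sd(1) orientedD(5) unfolding st_def by (metis mult_pos_pos)
  qed (simp add: t_Suc)
  then show ?thesis using sd(1)[of j] by (simp add: p_def pos_le_divide_eq)
qed

section \<open>The Gram matrix of the c-vectors\<close>

definition gram :: "3 \<Rightarrow> real^3^3 \<Rightarrow> 3 \<Rightarrow> 3 \<Rightarrow> real" where
  "gram q C i j = (\<Sum>a\<in>UNIV. \<Sum>b\<in>UNIV. C $ a $ i * (d a * A_init B q $ a $ b) * C $ b $ j)"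

lemma gram_commute: "gram q C i j = gram q C j i"
proof -
  have "d a * A_init B q $ a $ b = d b * A_init B q $ b $ a" for a b
  proof -
    have "d a * \<bar>B $ a $ b\<bar> = d b * \<bar>B $ b $ a\<bar>"
      using arg_cong[OF skew_B[of a b], of abs] d_pos[of a] d_pos[of b] by (simp add: abs_mult)
    then show ?thesis by (auto simp: A_init_def insert_commute)
  qed
  then have "C $ a $ i * (d a * A_init B q $ a $ b) * C $ b $ j
      = C $ b $ j * (d b * A_init B q $ b $ a) * C $ a $ i" for a b
    by (simp add: mult.commute mult.left_commute)
  then show ?thesis unfolding gram_def by (subst sum.swap) (intro sum.cong refl)
qed

lemma gram_combine:
  assumes "\<And>a. C' $ a $ i = u * C $ a $ i' + v * C $ a $ k"
    and "\<And>a. C' $ a $ j = u' * C $ a $ j' + v' * C $ a $ k'"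
  shows "gram q C' i j = u * u' * gram q C i' j' + u * v' * gram q C i' k'
      + v * u' * gram q C k j' + v * v' * gram q C k k'"
  unfolding gram_def assms
  by (simp add: sum_distrib_left sum.distrib[symmetric] algebra_simps)

text \<open>\<open>ready\<close> describes \<open>B\<^sup>w\<close>, \<open>C\<^sup>w\<close> just before a mutation at \<open>k\<close> and \<open>mutated\<close> just after it:
  \<open>j\<close> is the index whose c-vector absorbs a multiple of \<open>c\<^sub>k\<close>, \<open>s\<close> is the tropical sign of \<open>k\<close> before
  the mutation, and \<open>t\<close> that of \<open>l\<close>.\<close>

definition ready :: "3 \<Rightarrow> 3 \<Rightarrow> 3 \<Rightarrow> 3 \<Rightarrow> real \<Rightarrow> real \<Rightarrow> real^3^3 \<Rightarrow> real^3^3 \<Rightarrow> bool" where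
  "ready q k j l s t M C \<longleftrightarrow> oriented s k j l M \<and> t \<in> {1, -1} \<and>
     (\<forall>i. s * C $ i $ k \<ge> 0 \<and> t * C $ i $ l \<ge> 0 \<and>
       sqrt (d k) * (s * C $ i $ j + s * M $ k $ j * (s * C $ i $ k)) \<ge> sqrt (d j) * (s * C $ i $ k)) \<and>
     (\<forall>i. gram q C i i = 2 * d i) \<and>
     gram q C k j = - s * (d k * M $ k $ j) \<and> gram q C k l = t * (d k * M $ k $ l) \<and>
     gram q C j l = t * (d j * M $ j $ l)"

definition mutated :: "3 \<Rightarrow> 3 \<Rightarrow> 3 \<Rightarrow> 3 \<Rightarrow> real \<Rightarrow> real \<Rightarrow> real^3^3 \<Rightarrow> real^3^3 \<Rightarrow> bool" where
  "mutated q k j l s t M C \<longleftrightarrow> oriented s j k l M \<and> t \<in> {1, -1} \<and>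
     (\<forall>i. - s * C $ i $ k \<ge> 0 \<and> s * C $ i $ j \<ge> 0 \<and> t * C $ i $ l \<ge> 0 \<and>
       sqrt (d k) * (s * C $ i $ j) \<ge> sqrt (d j) * (- s * C $ i $ k)) \<and>
     (\<forall>i. gram q C i i = 2 * d i) \<and>
     gram q C k j = s * (d k * M $ k $ j) \<and> gram q C k l = t * (d k * M $ k $ l) \<and>
     gram q C j l = t * (d j * M $ j $ l)"

section \<open>One mutation, and the passage to the next letter\<close>

lemma mutated_step:
  assumes "ready q k j l s t M C" "cyclic_mat (mutation k M)"
  shows "mutated q k j l s t (mutation k M) (C_step k M C)"
proof -
  have o: "oriented s k j l M" and t: "t \<in> {1, -1}"
    and Ck: "\<And>i. s * C $ i $ k \<ge> 0" and Cl: "\<And>i. t * C $ i $ l \<ge> 0"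
    and Cj: "\<And>i. sqrt (d k) * (s * C $ i $ j + s * M $ k $ j * (s * C $ i $ k))
        \<ge> sqrt (d j) * (s * C $ i $ k)"
    and Gd: "\<And>i. gram q C i i = 2 * d i"
    and G: "gram q C k j = - s * (d k * M $ k $ j)" "gram q C k l = t * (d k * M $ k $ l)"
      "gram q C j l = t * (d j * M $ j $ l)"
    using assms(1) by (auto simp: ready_def)
  note O = orientedD[OF o] and mut = mutation_oriented[OF o]
  have ss: "s * s = 1" using O(1) by auto
  let ?C = "C_step k M C"
  note Ce = C_step_entry[OF skew_diag[OF O(3)] O(1) Ck]
  have e: "?C $ i $ k = - C $ i $ k" "?C $ i $ j = C $ i $ j + s * M $ k $ j * C $ i $ k"
    "?C $ i $ l = C $ i $ l" for i
    using O by (auto simp: Ce max_def)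
  have c: "?C $ i $ k = 0 * C $ i $ k + (- 1) * C $ i $ k"
    "?C $ i $ j = 1 * C $ i $ j + (s * M $ k $ j) * C $ i $ k"
    "?C $ i $ l = 1 * C $ i $ l + 0 * C $ i $ k" for i
    using e by simp_all
  \<comment> \<open>The inequality in \<open>ready\<close> says that the new c_j dominates c_k.
    Since \<open>s\<close> times c_k is nonnegative, it also gives the new c_j the sign
    \<open>s\<close>, whatever the sign of the old one.\<close>
  have bd: "sqrt (d k) * (s * ?C $ i $ j) \<ge> sqrt (d j) * (- s * ?C $ i $ k)" for i
    using Cj[of i] by (simp add: e algebra_simps)
  have "sqrt (d k) * (s * ?C $ i $ j) \<ge> 0" for i
    using bd[of i] Ck[of i] d_pos[of j]
    by (smt (verit) e mult_nonneg_nonneg real_sqrt_ge_0_iff mult_minus_left mult_minus_right)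
  then have jn: "s * ?C $ i $ j \<ge> 0" for i
    using d_pos[of k] by (metis zero_le_mult_iff real_sqrt_gt_0_iff not_less)
  have gkj: "gram q ?C k j = s * (d k * mutation k M $ k $ j)"
    by (simp add: gram_combine[OF c(1) c(2)] G Gd mut)
  have gkl: "gram q ?C k l = t * (d k * mutation k M $ k $ l)"
    by (simp add: gram_combine[OF c(1) c(3)] G Gd mut)
  have "gram q ?C j l = t * (d j * M $ j $ l) + s * t * (d k * M $ k $ j) * M $ k $ l"
    by (simp add: gram_combine[OF c(2) c(3)] G Gd)
  also have "\<dots> = t * (d j * mutation k M $ j $ l)"
    unfolding mut skewD[OF O(3), of k j] by (simp add: algebra_simps)
  finally have gjl: "gram q ?C j l = t * (d j * mutation k M $ j $ l)" .
  \<comment> \<open>The coefficient \<open>s * M $ k $ j\<close> is -2 (c_j, c_k) / (c_k, c_k), so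
    c_j is reflected in c_k and keeps its norm.\<close>
  have "gram q ?C j j = gram q C j j + 2 * (s * M $ k $ j) * gram q C k j
      + (s * M $ k $ j) * (s * M $ k $ j) * gram q C k k"
    by (simp add: gram_combine[OF c(2) c(2)] gram_commute[of q C j k])
  also have "\<dots> = 2 * d j"
    unfolding G Gd by (simp add: algebra_simps)
  finally have gjj: "gram q ?C j j = 2 * d j" .
  have "gram q ?C i i = 2 * d i" for i
    using three_cases[OF O(2), of i] gjj
    by (auto simp: gram_combine[OF c(1) c(1)] gram_combine[OF c(3) c(3)] Gd)
  then show ?thesis
    unfolding mutated_def using oriented_mutation[OF o assms(2)] t bd jn gkj gkl gjl Ck Cl
    by (auto simp: e(1,3))
qed

text \<open>The easy case: c_j already has the sign of c_k, so the absorbed multiple of c_k alone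
  yields the inequality in \<open>ready\<close>.\<close>

lemma ready_of_nonneg:
  assumes "distinct_adj (w @ [k])" "oriented s k j l (B_word B w)" "t \<in> {1, -1}"
    and "\<And>i. s * C $ i $ k \<ge> 0" "\<And>i. s * C $ i $ j \<ge> 0" "\<And>i. t * C $ i $ l \<ge> 0"
    and "\<And>i. gram q C i i = 2 * d i"
    and "gram q C k j = - s * (d k * B_word B w $ k $ j)"
      "gram q C k l = t * (d k * B_word B w $ k $ l)"
      "gram q C j l = t * (d j * B_word B w $ j $ l)"
  shows "ready q k j l s t (B_word B w) C"
proof -
  have "sqrt (d j) * (s * C $ i $ k)
      \<le> sqrt (d k) * (s * C $ i $ j + s * B_word B w $ k $ j * (s * C $ i $ k))" for i
  proof -
    have "2 * sqrt (d j) * (s * C $ i $ k) \<le> sqrt (d k) * (s * B_word B w $ k $ j) * (s * C $ i $ k)"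
      using entry_ge_2[OF assms(1,2)] assms(4)[of i] by (rule mult_right_mono)
    moreover have "sqrt (d k) * (s * C $ i $ j) \<ge> 0" "sqrt (d j) * (s * C $ i $ k) \<ge> 0"
      using assms(4,5)[of i] d_pos[of k] d_pos[of j] by (simp_all add: less_imp_le)
    ultimately show ?thesis by (simp add: distrib_left mult.assoc)
  qed
  then show ?thesis using assms unfolding ready_def by blast
qed

text \<open>For the identity matrix the Gram matrix is that of the form itself, and the signs in
  \<open>A_init\<close>, negative exactly at pairs containing \<open>q\<close>, are those
  \<open>ready\<close> demands before a first mutation at \<open>q\<close>.\<close>

lemma ready_initial:
  obtains j l where "ready q q j l 1 1 B (mat 1)"
proof -
  have ne: "distinct_adj ([] @ [q])" by simp
  obtain j l where o: "oriented 1 q j l (B_word B [])"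
    by (rule orientation_exists[OF skew_word cyclic_word, where s = 1 and k = q]) auto
  note O = orientedD[OF o]
  have g: "gram q (mat 1) i i' = d i * A_init B q $ i $ i'" for i i'
  proof -
    have "mat 1 $ a $ i * x * mat 1 $ b $ i' = (if b = i' then if a = i then x else 0 else 0)"
      for a b and x :: real
      by (simp add: mat_def)
    then show ?thesis unfolding gram_def by simp
  qed
  have "ready q q j l 1 1 (B_word B []) (mat 1)"
  proof (rule ready_of_nonneg[OF ne o])
    show "gram q (mat 1) q j = - 1 * (d q * B_word B [] $ q $ j)"
      "gram q (mat 1) q l = 1 * (d q * B_word B [] $ q $ l)"
      "gram q (mat 1) j l = 1 * (d j * B_word B [] $ j $ l)"
      "gram q (mat 1) i i = 2 * d i" for i
      using O(2,4,5,9) by (simp_all add: g A_init_def B_word_Nil)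
  qed (simp_all add: mat_def)
  then show thesis using that by (simp add: B_word_Nil)
qed

lemma ready_next:
  assumes m: "mutated q x y z s t (B_word B w) C" and w: "distinct_adj (w @ [k])" and k: "k \<noteq> x"
  shows "\<exists>j l s' t'. ready q k j l s' t' (B_word B w) C"
proof -
  let ?M = "B_word B w"
  have o: "oriented s y x z ?M" and t: "t \<in> {1, -1}"
    and Cx: "\<And>i. - s * C $ i $ x \<ge> 0" and Cy: "\<And>i. s * C $ i $ y \<ge> 0"
    and Cz: "\<And>i. t * C $ i $ z \<ge> 0"
    and Cxy: "\<And>i. sqrt (d x) * (s * C $ i $ y) \<ge> sqrt (d y) * (- s * C $ i $ x)"
    and Gd: "\<And>i. gram q C i i = 2 * d i"
    and G: "gram q C x y = s * (d x * ?M $ x $ y)" "gram q C x z = t * (d x * ?M $ x $ z)"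
      "gram q C y z = t * (d y * ?M $ y $ z)"
    using m by (auto simp: mutated_def)
  note O = orientedD[OF o]
  note sk = skewD[OF O(3)]
  note G' = gram_commute[of q C y x] gram_commute[of q C z x] gram_commute[of q C z y]
  consider "k = y" | "k = z" "t = s" | "k = z" "t = - s"
    using three_cases[OF O(2), of k] k t O(1) by auto
  then show ?thesis
  proof cases
    case 1
    \<comment> \<open>The delicate case: c_x has sign \<open>- s\<close>. Of the two copies of
      \<open>sqrt (d x) * (s * C $ i $ y)\<close> supplied by \<open>entry_ge_2\<close>, one cancels
      c_x by \<open>Cxy\<close> and the other remains.\<close>
    have "sqrt (d x) * (s * C $ i $ y)
        \<le> sqrt (d y) * (s * C $ i $ x + s * ?M $ y $ x * (s * C $ i $ y))" for i
    proof -
      have "2 * sqrt (d x) * (s * C $ i $ y) \<le> sqrt (d y) * (s * ?M $ y $ x) * (s * C $ i $ y)"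
        using entry_ge_2[OF _ o] w 1 Cy[of i] by (intro mult_right_mono) auto
      then show ?thesis using Cxy[of i] by (simp add: distrib_left mult.assoc)
    qed
    then have "ready q y x z s t ?M C"
      unfolding ready_def using o t Cy Cz Gd G G' sk[of x y] by simp
    then show ?thesis using 1 by blast
  next
    case 2
    \<comment> \<open>For \<open>k = z\<close> the sign \<open>t\<close> decides the direction of
      the cycle, and in both cases the absorbing index, \<open>y\<close> or \<open>x\<close>, has
      that same sign.\<close>
    have "ready q z y x s (- s) ?M C"
    proof (rule ready_of_nonneg)
      show "oriented s z y x ?M" using O unfolding oriented_def by auto
    qed (use w O(1) 2 Cx Cy Cz Gd G G' sk[of x y] sk[of x z] sk[of y z] in auto)
    then show ?thesis using 2 by blast
  next
    case 3
    have "ready q z x y t s ?M C"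
    proof (rule ready_of_nonneg)
      show "oriented t z x y ?M" using O 3 unfolding oriented_def by auto
    qed (use w O(1) 3 Cx Cy Cz Gd G G' sk[of x y] sk[of x z] sk[of y z] in auto)
    then show ?thesis using 3 by blast
  qed
qed

section \<open>Induction along the word\<close>

lemma mutated_word:
  assumes "distinct_adj w" "w \<noteq> []"
  shows "\<exists>j l s t. mutated (hd w) (last w) j l s t (B_word B w) (C_word B w)"
  using assms
proof (induction w rule: rev_induct)
  case (snoc k w)
  have "\<exists>j l s t. ready (hd (w @ [k])) k j l s t (B_word B w) (C_word B w)"
  proof (cases "w = []")
    case True
    obtain j l where "ready k k j l 1 1 B (mat 1)" by (rule ready_initial)
    then show ?thesis unfolding True by (auto simp: B_word_Nil C_word_Nil)
  next
    case False
    then obtain j l s t where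
      "mutated (hd w) (last w) j l s t (B_word B w) (C_word B w)" "k \<noteq> last w"
      using snoc by (auto simp: distinct_adj_append_iff)
    from ready_next[OF this(1) snoc.prems(1) this(2)] show ?thesis using False by simp
  qed
  then obtain j l s t where "ready (hd (w @ [k])) k j l s t (B_word B w) (C_word B w)" by blast
  from mutated_step[OF this] cyclic_word[OF snoc.prems(1)]
  have "mutated (hd (w @ [k])) k j l s t (B_word B (w @ [k])) (C_word B (w @ [k]))"
    by (simp add: B_word_snoc C_word_snoc)
  then show ?case unfolding last_snoc by blast
qed simp

section \<open>Tropical signs and the comparison with \<open>A_word\<close>\<close>

lemma gram_matrix:
  assumes "D = diag_mat (\<chi> i. d i)"
  shows "(transpose C ** (D ** A_init B q) ** C) $ i $ j = gram q C i j"
proof -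
  have "(D ** A_init B q) $ a $ b = d a * A_init B q $ a $ b" for a b
    unfolding assms diag_mat_def matrix_matrix_mult_def
    by (simp add: if_distrib if_distribR cong: if_cong)
  then show ?thesis
    unfolding gram_def matrix_matrix_mult_def[of _ C] matrix_matrix_mult_def[of "transpose C"]
    by (simp add: transpose_def sum_distrib_right) (rule sum.swap)
qed

text \<open>A nonzero norm makes the c-vector nonzero, so its sign is unique.\<close>

lemma tropical_sign_eq:
  assumes "e \<in> {1, -1}" "\<And>a. e * C_word B w $ a $ i \<ge> 0" "gram q (C_word B w) i i \<noteq> 0"
  shows "tropical_sign B w i = e"
proof -
  obtain a where a: "C_word B w $ a $ i \<noteq> 0"
    using assms(3) unfolding gram_def by fastforce
  show ?thesis
    unfolding tropical_sign_def
  proof (rule the_equality)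
    show "e \<in> {1, - 1} \<and> 0 \<le> e *\<^sub>R column i (C_word B w)"
      using assms by (auto simp: less_eq_vec_def column_def)
  next
    fix e' :: real
    assume e': "e' \<in> {1, - 1} \<and> 0 \<le> e' *\<^sub>R column i (C_word B w)"
    then have "e' * C_word B w $ a $ i \<ge> 0" by (auto simp: less_eq_vec_def column_def)
    then show "e' = e" using e' a assms(1) assms(2)[of a] by auto
  qed
qed

lemma gram_word:
  assumes m: "mutated q k j l s t (B_word B w) (C_word B w)"
  shows "gram q (C_word B w) a b = d a * A_word B w $ a $ b"
proof -
  let ?M = "B_word B w" and ?C = "C_word B w"
  have o: "oriented s j k l ?M" and t: "t \<in> {1, -1}"
    and Gd: "\<And>i. gram q ?C i i = 2 * d i"
    and G: "gram q ?C k j = s * (d k * ?M $ k $ j)" "gram q ?C k l = t * (d k * ?M $ k $ l)"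
      "gram q ?C j l = t * (d j * ?M $ j $ l)"
    using m by (auto simp: mutated_def)
  note O = orientedD[OF o]
  have sgn: "tropical_sign B w k = - s" "tropical_sign B w j = s" "tropical_sign B w l = t"
    using m O(1) t Gd d_pos
    by (auto intro!: tropical_sign_eq[where q = q] simp: mutated_def less_imp_neq[symmetric])
  have A: "A_word B w $ i $ i = 2" for i by (simp add: A_word_def)
  \<comment> \<open>The pair (\<open>k\<close>, \<open>j\<close>) always lies in
    \<open>P_word\<close>, (\<open>k\<close>, \<open>l\<close>) exactly if \<open>t = - s\<close>,
    and (\<open>j\<close>, \<open>l\<close>) exactly if \<open>t = s\<close>.\<close>
  have "gram q ?C k j = d k * A_word B w $ k $ j" "gram q ?C k l = d k * A_word B w $ k $ l"
    "gram q ?C j l = d j * A_word B w $ j $ l"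
    using O t unfolding G A_word_def P_word_def by (auto simp: sgn)
  moreover have "d i * A_word B w $ i $ i' = d i' * A_word B w $ i' $ i" for i i'
  proof -
    have "d i * \<bar>?M $ i $ i'\<bar> = d i' * \<bar>?M $ i' $ i\<bar>"
      using arg_cong[OF skewD[OF O(3), of i i'], of abs] d_pos[of i] d_pos[of i']
      by (simp add: abs_mult)
    then show ?thesis by (auto simp: A_word_def P_word_def)
  qed
  ultimately show ?thesis
    using three_cases[OF O(2), of a] three_cases[OF O(2), of b] Gd A gram_commute[of q ?C]
    by (metis mult.commute)
qed

end

theorem theorem4p9:
  fixes B D :: "real^3^3" and w :: "3 list"
  assumes "skew_symmetrizer D B"
    and "cluster_cyclic B"
    and "distinct_adj w"
    and "w \<noteq> []"
  shows "transpose (C_word B w) ** (D ** A_init B (hd w)) ** C_word B w = D ** A_word B w"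
proof -
  obtain d where d: "\<And>i. d $ i > 0" "D = diag_mat d" and sk: "transpose (D ** B) = - (D ** B)"
    using assms(1) by (auto simp: skew_symmetrizer_def)
  have DX: "(D ** X) $ i $ j = d $ i * X $ i $ j" for X :: "real^3^3" and i j
    unfolding d(2) diag_mat_def matrix_matrix_mult_def
    by (simp add: if_distrib if_distribR cong: if_cong)
  have "d $ i * B $ i $ j = - d $ j * B $ j $ i" for i j
    using arg_cong[OF sk, of "\<lambda>X. X $ j $ i"] by (simp add: transpose_def DX)
  then interpret exchange B "\<lambda>i. d $ i"
    using d(1) assms(2) by unfold_locales
  obtain j l s t where m: "mutated (hd w) (last w) j l s t (B_word B w) (C_word B w)"
    using mutated_word[OF assms(3,4)] by blast
  have "D = diag_mat (\<chi> i. d $ i)" using d(2) by simp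
  then show ?thesis by (simp add: vec_eq_iff DX gram_matrix gram_word[OF m])
qed

end
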